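(* Let $R$ be a unital associative and commutative ring such that $\frac13 \in R$ and let $A$ be a unital associative $R$-algebra generated by a set $X$. Let $U$ be a two-sided ideal in $A$ generated by a set $S$ and let $W$ be the two-sided ideal in $A$ generated by the set \[ \bigl\{ [u, a_1, a_2] \mid u \in U, \ a_1, a_2 \in A \bigr\} . \] Then the ideal $W$ of $A$ is generated (as a two-sided ideal) by the following elements, where $s$ ranges over $S$ and all $x_i$ range over $X$: \[ [s, x_1, x_2], \] \[ s [x_1, x_2, x_3], \] \[ [s, x_1] [x_2, x_3] + [s, x_2] [x_1, x_3], \] \[ s \bigl( [x_1, x_2] [x_3, x_4] + [x_1, x_3] [x_2, x_4] \bigr). \]
   Context: $\frac13\in R$ means that $3=1+1+1$ is invertible in $R$. Commutators are additive and left-normed: $[a_1,a_2] = a_1a_2 - a_2a_1$ and $[a_1,a_2,a_3] = \bigl[[a_1,a_2],a_3\bigr]$. "Generated by $X$" means generated as a unital $R$-algebra. *)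

theory Defs
  imports "HOL-Algebra.Ideal" "HOL-Algebra.Module" "HOL-Algebra.Subrings"
begin

text \<open>
  Unital associative algebras over a commutative ring. The library locale \<open>algebra\<close>
  cannot be used, since it requires the algebra itself to be commutative; for the same
  reason both compatibility laws between scaling and multiplication are needed here.
\<close>

locale assoc_algebra = module R A + A?: ring A
  for R :: "('r, 'm) ring_scheme" (structure)
    and A :: "('r, 'a, 'n) module_scheme" (structure) +
  assumes smult_mult_left:
      "\<lbrakk>r \<in> carrier R; x \<in> carrier A; y \<in> carrier A\<rbrakk> \<Longrightarrow>
        (r \<odot>\<^bsub>A\<^esub> x) \<otimes>\<^bsub>A\<^esub> y = r \<odot>\<^bsub>A\<^esub> (x \<otimes>\<^bsub>A\<^esub> y)"
    and smult_mult_right: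
      "\<lbrakk>r \<in> carrier R; x \<in> carrier A; y \<in> carrier A\<rbrakk> \<Longrightarrow>
        x \<otimes>\<^bsub>A\<^esub> (r \<odot>\<^bsub>A\<^esub> y) = r \<odot>\<^bsub>A\<^esub> (x \<otimes>\<^bsub>A\<^esub> y)"

text \<open>
  The unital subalgebra generated by a set: \<open>subring\<close> includes the unit of \<open>A\<close>.
\<close>

definition generated_subalgebra ::
    "('r, 'm) ring_scheme \<Rightarrow> ('r, 'a, 'n) module_scheme \<Rightarrow> 'a set \<Rightarrow> 'a set"
  where "generated_subalgebra R A X =
    \<Inter>{B. subring B A \<and> submodule B R A \<and> X \<subseteq> B}"

definition commutator :: "('a, 'm) ring_scheme \<Rightarrow> 'a \<Rightarrow> 'a \<Rightarrow> 'a"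
    (\<open>\<lbrakk>_, _\<rbrakk>\<index>\<close>)
  where "commutator A a b = (a \<otimes>\<^bsub>A\<^esub> b) \<ominus>\<^bsub>A\<^esub> (b \<otimes>\<^bsub>A\<^esub> a)"

text \<open>Longer commutators are left-normed.\<close>

abbreviation commutator3 :: "('a, 'm) ring_scheme \<Rightarrow> 'a \<Rightarrow> 'a \<Rightarrow> 'a \<Rightarrow> 'a"
    (\<open>\<lbrakk>_, _, _\<rbrakk>\<index>\<close>)
  where "commutator3 A a b c \<equiv> commutator A (commutator A a b) c"

end

theory Submission
  imports Defs "HOL-Algebra.Generated_Rings"
begin

text \<open>
  Write \<open>I\<close> for the ideal generated by the four families, and
  \<open>p(s; a, b, c) = [s, a][b, c] + [s, b][a, c]\<close> for the expression in the third family. The fourth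
  family consists of the \<open>s p(x1; x2, x3, x4)\<close>.

  The inclusion \<open>I \<subseteq> W\<close> is the easy one. For \<open>u\<close> in the ideal \<open>U\<close>, the element \<open>u a\<close> is in \<open>U\<close> too, and
  \<open>[u a, b, c] = u [a, b, c] - p(u; b, c, a) + [u, b, c] a\<close>. Modulo \<open>W\<close> this identifies \<open>u [a, b, c]\<close>
  with an expression symmetric in \<open>b\<close> and \<open>c\<close>, and the Jacobi identity then forces both
  to vanish (\<open>mult_commutator3_mem\<close>, \<open>polarized_mem\<close>). The fourth family results from the third on
  replacing \<open>u\<close> by \<open>u a\<close> (\<open>mult_polarized_mem\<close>).

  For \<open>W \<subseteq> I\<close>, observe that modulo \<open>I\<close> the commutators \<open>[s, x]\<close> with \<open>s \<in> S\<close> and \<open>x \<in> X\<close> commute with \<open>X\<close>, hence are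
  central. The third family makes \<open>[s, x][y, z, w]\<close> alternating in \<open>x\<close>, \<open>y\<close>, \<open>z\<close>; together with
  the Jacobi identity this yields \<open>3 [s, x][y, z, w] = 0\<close>, and \<open>3\<close> is invertible
  (\<open>commutator_mult_commutator3_mem\<close>). A similar sign argument gives \<open>[s, v] p(w; x, y, z) = 0\<close>
  (\<open>commutator_mult_polarized_mem\<close>). Consequently the ideal of all \<open>q\<close> with \<open>U q \<subseteq> I\<close> contains
  \<open>[x, y, z]\<close> and \<open>p(w; x, y, z)\<close> for all generators, and these two families are enough to generate
  all triple commutators (\<open>commutator3_mem_if_generators\<close>). So \<open>U [a, b, c] \<subseteq> I\<close> for all \<open>a\<close>, \<open>b\<close>,
  \<open>c\<close>. With this, the relations \<open>[s, x, y] = 0\<close> and \<open>p(s; x, y, z) = 0\<close> extend from generators to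
  arbitrary arguments: modulo \<open>I\<close>, the expression \<open>p(s; a, b, c)\<close> behaves as a derivation in one
  argument at a time, and it is the obstruction to \<open>[s, a b]\<close> being central when \<open>[s, a]\<close> and \<open>[s, b]\<close>
  are (\<open>polarized_mem_generator\<close>, \<open>commutator_central\<close>, \<open>polarized_mem_first\<close>). The
  expansion of \<open>[d s, b, c]\<close> then shows that it lies in \<open>I\<close>, and a short
  argument passes from the \<open>d s\<close> to all of \<open>U\<close> (\<open>commutator3_mem_if_families\<close>).

  All of this takes place in a ring generated by a set. An algebra over \<open>R\<close> generated by \<open>X\<close> is a
  ring generated by \<open>X\<close> and the scalars; as scalars are central, enlarging \<open>X\<close> by them adds only zeros
  to the four families.
\<close>

section \<open>Commutator calculus\<close>

context ring
begin

lemma commutator_closed [simp, intro, algebra ring "zero R" "add R" "a_inv R" "a_minus R" "one R" "mult R"]: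
  "\<lbrakk>a \<in> carrier R; b \<in> carrier R\<rbrakk> \<Longrightarrow> \<lbrakk>a, b\<rbrakk> \<in> carrier R"
  by (simp add: commutator_def)

lemma commutator_mult_right:
  "\<lbrakk>v \<in> carrier R; a \<in> carrier R; b \<in> carrier R\<rbrakk> \<Longrightarrow>
    \<lbrakk>v, a \<otimes> b\<rbrakk> = a \<otimes> \<lbrakk>v, b\<rbrakk> \<oplus> \<lbrakk>v, a\<rbrakk> \<otimes> b"
  unfolding commutator_def by algebra

lemma commutator_mult_left:
  "\<lbrakk>v \<in> carrier R; a \<in> carrier R; b \<in> carrier R\<rbrakk> \<Longrightarrow>
    \<lbrakk>a \<otimes> b, v\<rbrakk> = a \<otimes> \<lbrakk>b, v\<rbrakk> \<oplus> \<lbrakk>a, v\<rbrakk> \<otimes> b"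
  unfolding commutator_def by algebra

lemma commutator_add_right:
  "\<lbrakk>v \<in> carrier R; a \<in> carrier R; b \<in> carrier R\<rbrakk> \<Longrightarrow> \<lbrakk>v, a \<oplus> b\<rbrakk> = \<lbrakk>v, a\<rbrakk> \<oplus> \<lbrakk>v, b\<rbrakk>"
  unfolding commutator_def by algebra

lemma commutator_add_left:
  "\<lbrakk>v \<in> carrier R; a \<in> carrier R; b \<in> carrier R\<rbrakk> \<Longrightarrow> \<lbrakk>a \<oplus> b, v\<rbrakk> = \<lbrakk>a, v\<rbrakk> \<oplus> \<lbrakk>b, v\<rbrakk>"
  unfolding commutator_def by algebra

lemma commutator_uminus_right:
  "\<lbrakk>v \<in> carrier R; a \<in> carrier R\<rbrakk> \<Longrightarrow> \<lbrakk>v, \<ominus> a\<rbrakk> = \<ominus> \<lbrakk>v, a\<rbrakk>"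
  unfolding commutator_def by algebra

lemma commutator_uminus_left:
  "\<lbrakk>v \<in> carrier R; a \<in> carrier R\<rbrakk> \<Longrightarrow> \<lbrakk>\<ominus> a, v\<rbrakk> = \<ominus> \<lbrakk>a, v\<rbrakk>"
  unfolding commutator_def by algebra

lemma commutator_one_right: "v \<in> carrier R \<Longrightarrow> \<lbrakk>v, \<one>\<rbrakk> = \<zero>"
  by (simp add: commutator_def a_minus_def r_neg)

lemma commutator_one_left: "v \<in> carrier R \<Longrightarrow> \<lbrakk>\<one>, v\<rbrakk> = \<zero>"
  by (simp add: commutator_def a_minus_def r_neg)

lemma commutator_zero_left: "v \<in> carrier R \<Longrightarrow> \<lbrakk>\<zero>, v\<rbrakk> = \<zero>"
  unfolding commutator_def by algebra

lemma commutator_swap: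
  "\<lbrakk>a \<in> carrier R; b \<in> carrier R\<rbrakk> \<Longrightarrow> \<lbrakk>a, b\<rbrakk> = \<ominus> \<lbrakk>b, a\<rbrakk>"
  unfolding commutator_def by algebra

lemma mult_eq_swap_add_commutator:
  "\<lbrakk>a \<in> carrier R; b \<in> carrier R\<rbrakk> \<Longrightarrow> a \<otimes> b = b \<otimes> a \<oplus> \<lbrakk>a, b\<rbrakk>"
  unfolding commutator_def by algebra

lemma eq_minusI:
  "\<lbrakk>x = y \<oplus> z; y \<in> carrier R; z \<in> carrier R\<rbrakk> \<Longrightarrow> y = x \<ominus> z"
  by (simp add: a_minus_def a_assoc r_neg)

lemma jacobi:
  "\<lbrakk>a \<in> carrier R; b \<in> carrier R; c \<in> carrier R\<rbrakk> \<Longrightarrow>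
    \<lbrakk>a, b, c\<rbrakk> \<oplus> \<lbrakk>b, c, a\<rbrakk> \<ominus> \<lbrakk>a, c, b\<rbrakk> = \<zero>"
  unfolding commutator_def by algebra

text \<open>The Jacobi identity in the form: bracketing with \<open>s\<close> is a derivation of the bracket.\<close>

lemma commutator_of_commutator:
  "\<lbrakk>s \<in> carrier R; a \<in> carrier R; b \<in> carrier R\<rbrakk> \<Longrightarrow>
    \<lbrakk>s, \<lbrakk>a, b\<rbrakk>\<rbrakk> = \<lbrakk>s, a, b\<rbrakk> \<ominus> \<lbrakk>s, b, a\<rbrakk>"
  unfolding commutator_def by algebra

text \<open>
  The polarization of \<open>\<lbrakk>s, a\<rbrakk> \<otimes> \<lbrakk>a, c\<rbrakk>\<close>. Its vanishing means that \<open>\<lbrakk>s, a\<rbrakk> \<otimes> \<lbrakk>b, c\<rbrakk>\<close> changes sign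
  under exchange of \<open>a\<close> and \<open>b\<close>, which is how it is used below.
\<close>

abbreviation polarized :: "'a \<Rightarrow> 'a \<Rightarrow> 'a \<Rightarrow> 'a \<Rightarrow> 'a"
  where "polarized s a b c \<equiv> \<lbrakk>s, a\<rbrakk> \<otimes> \<lbrakk>b, c\<rbrakk> \<oplus> \<lbrakk>s, b\<rbrakk> \<otimes> \<lbrakk>a, c\<rbrakk>"

lemma commutator3_mult_left:
  assumes "u \<in> carrier R" "a \<in> carrier R" "b \<in> carrier R" "c \<in> carrier R"
  shows "\<lbrakk>u \<otimes> a, b, c\<rbrakk> = u \<otimes> \<lbrakk>a, b, c\<rbrakk> \<ominus> polarized u b c a \<oplus> \<lbrakk>u, b, c\<rbrakk> \<otimes> a"
proof -
  have "\<lbrakk>c, a\<rbrakk> = \<ominus> \<lbrakk>a, c\<rbrakk>" "\<lbrakk>b, a\<rbrakk> = \<ominus> \<lbrakk>a, b\<rbrakk>"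
    using assms by (simp_all only: commutator_swap[of c a] commutator_swap[of b a])
  then show ?thesis
    using assms
    by (simp only: commutator_mult_left commutator_add_left commutator_closed m_closed) algebra
qed

text \<open>
  The same expansion with every factor involving \<open>s\<close> moved to the left, so that the correction
  terms are commutators which vanish, by the Jacobi identity in the last case, when all \<open>\<lbrakk>s, x\<rbrakk>\<close> are
  central.
\<close>

lemma commutator3_mult_left_central_form:
  assumes "d \<in> carrier R" "s \<in> carrier R" "b \<in> carrier R" "c \<in> carrier R"
  shows "\<lbrakk>d \<otimes> s, b, c\<rbrakk> = d \<otimes> \<lbrakk>s, b, c\<rbrakk>
    \<ominus> (polarized s b c d \<oplus> \<lbrakk>s, c, \<lbrakk>d, b\<rbrakk>\<rbrakk> \<oplus> \<lbrakk>s, b, \<lbrakk>d, c\<rbrakk>\<rbrakk>)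
    \<oplus> (s \<otimes> \<lbrakk>d, b, c\<rbrakk> \<ominus> \<lbrakk>s, \<lbrakk>d, b, c\<rbrakk>\<rbrakk>)"
proof -
  have move: "\<lbrakk>d, x\<rbrakk> \<otimes> \<lbrakk>y, s\<rbrakk> = \<lbrakk>s, y\<rbrakk> \<otimes> \<lbrakk>x, d\<rbrakk> \<oplus> \<lbrakk>s, y, \<lbrakk>d, x\<rbrakk>\<rbrakk>"
    if "x \<in> carrier R" "y \<in> carrier R" for x y
  proof -
    have move_generic: "p \<otimes> \<ominus> q = q \<otimes> \<ominus> p \<oplus> \<lbrakk>q, p\<rbrakk>" if "p \<in> carrier R" "q \<in> carrier R" for p q
      using that unfolding commutator_def by algebra
    show ?thesis
      unfolding commutator_swap[OF that(2) assms(2)] commutator_swap[OF that(1) assms(1)]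
      by (rule move_generic) (use that assms in auto)
  qed
  have move3: "\<lbrakk>d, b, c\<rbrakk> \<otimes> s = s \<otimes> \<lbrakk>d, b, c\<rbrakk> \<ominus> \<lbrakk>s, \<lbrakk>d, b, c\<rbrakk>\<rbrakk>"
    using assms by (intro eq_minusI mult_eq_swap_add_commutator) auto
  show ?thesis
    unfolding commutator3_mult_left[OF assms(1,2,3,4)] move3 move[OF assms(3,4)] move[OF assms(4,3)]
    using assms by algebra
qed

text \<open>
  The Leibniz expression \<open>x \<otimes> p \<oplus> q \<otimes> a\<close>, where \<open>p\<close> and \<open>q\<close> stand for the values of a derivation
  at \<open>a\<close> and \<open>x\<close>, keeps its form under multiplication up to a commutator.
\<close>

lemma mult_leibniz_left:
  assumes "u \<in> carrier R" "x \<in> carrier R" "a \<in> carrier R" "p \<in> carrier R" "q \<in> carrier R"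
  shows "u \<otimes> (x \<otimes> p \<oplus> q \<otimes> a) = x \<otimes> (u \<otimes> p) \<oplus> (u \<otimes> q) \<otimes> a \<oplus> \<lbrakk>u, x\<rbrakk> \<otimes> p"
  using assms unfolding commutator_def by algebra

lemma mult_leibniz_right:
  assumes "u \<in> carrier R" "x \<in> carrier R" "a \<in> carrier R" "p \<in> carrier R" "q \<in> carrier R"
  shows "(x \<otimes> p \<oplus> q \<otimes> a) \<otimes> u = x \<otimes> (p \<otimes> u) \<oplus> (q \<otimes> u) \<otimes> a \<ominus> q \<otimes> \<lbrakk>u, a\<rbrakk>"
  using assms unfolding commutator_def by algebra

lemma ideal_add: "\<lbrakk>ideal I R; a \<in> I; b \<in> I\<rbrakk> \<Longrightarrow> a \<oplus> b \<in> I"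
  by (rule additive_subgroup.a_closed[OF ideal.axioms(1)])

lemma ideal_uminus: "\<lbrakk>ideal I R; a \<in> I\<rbrakk> \<Longrightarrow> \<ominus> a \<in> I"
  by (rule additive_subgroup.a_inv_closed[OF ideal.axioms(1)])

lemma ideal_minus: "\<lbrakk>ideal I R; a \<in> I; b \<in> I\<rbrakk> \<Longrightarrow> a \<ominus> b \<in> I"
  by (simp add: a_minus_def ideal_add ideal_uminus)

lemma ideal_zero: "ideal I R \<Longrightarrow> \<zero> \<in> I"
  by (rule additive_subgroup.zero_closed[OF ideal.axioms(1)])

lemma ideal_mult_left: "\<lbrakk>ideal I R; a \<in> I; x \<in> carrier R\<rbrakk> \<Longrightarrow> x \<otimes> a \<in> I"
  by (rule ideal.I_l_closed)

lemma ideal_mult_right: "\<lbrakk>ideal I R; a \<in> I; x \<in> carrier R\<rbrakk> \<Longrightarrow> a \<otimes> x \<in> I"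
  by (rule ideal.I_r_closed)

lemmas ideal_intros = ideal_add ideal_uminus ideal_minus ideal_zero ideal_mult_left ideal_mult_right

lemma ideal_commutator_left: "\<lbrakk>ideal I R; a \<in> I; x \<in> carrier R\<rbrakk> \<Longrightarrow> \<lbrakk>a, x\<rbrakk> \<in> I"
  unfolding commutator_def by (intro ideal_intros)

lemma idealI_closed:
  assumes "J \<subseteq> carrier R" "\<zero> \<in> J"
    and "\<And>a b. \<lbrakk>a \<in> J; b \<in> J\<rbrakk> \<Longrightarrow> a \<oplus> b \<in> J"
    and l: "\<And>x a. \<lbrakk>x \<in> carrier R; a \<in> J\<rbrakk> \<Longrightarrow> x \<otimes> a \<in> J"
    and r: "\<And>x a. \<lbrakk>x \<in> carrier R; a \<in> J\<rbrakk> \<Longrightarrow> a \<otimes> x \<in> J"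
  shows "ideal J R"
proof (rule idealI[OF ring_axioms])
  have "\<ominus> a \<in> J" if "a \<in> J" for a
    using l[of "\<ominus> \<one>" a] that assms(1) by (auto simp: l_minus)
  then show "subgroup J (add_monoid R)"
    using assms by (intro add.subgroupI) auto
qed (use l r in auto)

section \<open>The ideal contains the four families\<close>

context
  fixes U W
  assumes U: "ideal U R" and W: "ideal W R"
    and UW: "\<And>u a b. \<lbrakk>u \<in> U; a \<in> carrier R; b \<in> carrier R\<rbrakk> \<Longrightarrow> \<lbrakk>u, a, b\<rbrakk> \<in> W"
begin

lemma mult_commutator3_minus_polarized_mem:
  assumes u: "u \<in> U" and abc: "a \<in> carrier R" "b \<in> carrier R" "c \<in> carrier R"
  shows "u \<otimes> \<lbrakk>a, b, c\<rbrakk> \<ominus> polarized u b c a \<in> W"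
proof -
  have uc: "u \<in> carrier R" using ideal.Icarr[OF U u] .
  have "u \<otimes> \<lbrakk>a, b, c\<rbrakk> \<ominus> polarized u b c a = \<lbrakk>u \<otimes> a, b, c\<rbrakk> \<ominus> \<lbrakk>u, b, c\<rbrakk> \<otimes> a"
    unfolding commutator3_mult_left[OF uc abc] using uc abc by algebra
  also have "\<dots> \<in> W"
    using u uc abc by (intro ideal_intros[OF W] UW ideal_mult_right[OF U])
  finally show ?thesis .
qed

text \<open>
  Modulo \<open>W\<close>, the previous lemma equates both \<open>u \<otimes> \<lbrakk>c, b, a\<rbrakk>\<close> and \<open>u \<otimes> \<lbrakk>c, a, b\<rbrakk>\<close> with the same
  expression, since \<open>polarized u a b c\<close> is symmetric in \<open>a\<close> and \<open>b\<close>. By the Jacobi identity their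
  difference is \<open>u \<otimes> \<lbrakk>a, b, c\<rbrakk>\<close>.
\<close>

lemma mult_commutator3_mem:
  assumes u: "u \<in> U" and abc: "a \<in> carrier R" "b \<in> carrier R" "c \<in> carrier R"
  shows "u \<otimes> \<lbrakk>a, b, c\<rbrakk> \<in> W"
proof -
  have uc: "u \<in> carrier R" using ideal.Icarr[OF U u] .
  have "\<lbrakk>a, b, c\<rbrakk> = \<lbrakk>c, b, a\<rbrakk> \<ominus> \<lbrakk>c, a, b\<rbrakk>"
    using abc unfolding commutator_def by algebra
  then have "u \<otimes> \<lbrakk>a, b, c\<rbrakk> =
      (u \<otimes> \<lbrakk>c, b, a\<rbrakk> \<ominus> polarized u b a c) \<ominus> (u \<otimes> \<lbrakk>c, a, b\<rbrakk> \<ominus> polarized u a b c)"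
    using uc abc by (simp only:) algebra
  also have "\<dots> \<in> W"
    using assms by (intro ideal_minus[OF W] mult_commutator3_minus_polarized_mem)
  finally show ?thesis .
qed

lemma polarized_mem:
  assumes u: "u \<in> U" and abc: "a \<in> carrier R" "b \<in> carrier R" "c \<in> carrier R"
  shows "polarized u a b c \<in> W"
proof -
  have uc: "u \<in> carrier R" using ideal.Icarr[OF U u] .
  have "polarized u a b c = u \<otimes> \<lbrakk>c, a, b\<rbrakk> \<ominus> (u \<otimes> \<lbrakk>c, a, b\<rbrakk> \<ominus> polarized u a b c)"
    using uc abc by algebra
  also have "\<dots> \<in> W"
    using assms by (intro ideal_minus[OF W] mult_commutator3_minus_polarized_mem mult_commutator3_mem)
  finally show ?thesis .
qed

text \<open>
  Replace \<open>u\<close> by \<open>u \<otimes> a\<close> in \<open>polarized u b c d\<close> and expand: since \<open>\<lbrakk>u, b\<rbrakk>\<close> and \<open>\<lbrakk>u, c\<rbrakk>\<close> commute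
  with \<open>a\<close> modulo \<open>W\<close>, what remains besides \<open>u \<otimes> polarized a b c d\<close> is a multiple of
  \<open>polarized u b c d\<close>.
\<close>

lemma mult_polarized_mem:
  assumes u: "u \<in> U" and abcd: "a \<in> carrier R" "b \<in> carrier R" "c \<in> carrier R" "d \<in> carrier R"
  shows "u \<otimes> polarized a b c d \<in> W"
proof -
  have uc: "u \<in> carrier R" using ideal.Icarr[OF U u] .
  have comm: "\<lbrakk>u, b\<rbrakk> \<otimes> a = a \<otimes> \<lbrakk>u, b\<rbrakk> \<oplus> \<lbrakk>u, b, a\<rbrakk>" "\<lbrakk>u, c\<rbrakk> \<otimes> a = a \<otimes> \<lbrakk>u, c\<rbrakk> \<oplus> \<lbrakk>u, c, a\<rbrakk>"
    using uc abcd by (simp_all only: mult_eq_swap_add_commutator[of "\<lbrakk>u, b\<rbrakk>" a]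
        mult_eq_swap_add_commutator[of "\<lbrakk>u, c\<rbrakk>" a] commutator_closed)
  have "polarized (u \<otimes> a) b c d = u \<otimes> polarized a b c d
      \<oplus> (\<lbrakk>u, b\<rbrakk> \<otimes> a \<otimes> \<lbrakk>c, d\<rbrakk> \<oplus> \<lbrakk>u, c\<rbrakk> \<otimes> a \<otimes> \<lbrakk>b, d\<rbrakk>)"
    using uc abcd by (simp only: commutator_mult_left) algebra
  also have "\<dots> = u \<otimes> polarized a b c d
      \<oplus> (a \<otimes> polarized u b c d \<oplus> \<lbrakk>u, b, a\<rbrakk> \<otimes> \<lbrakk>c, d\<rbrakk> \<oplus> \<lbrakk>u, c, a\<rbrakk> \<otimes> \<lbrakk>b, d\<rbrakk>)"
    unfolding comm using uc abcd by algebra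
  finally have eq: "u \<otimes> polarized a b c d = polarized (u \<otimes> a) b c d
      \<ominus> (a \<otimes> polarized u b c d \<oplus> \<lbrakk>u, b, a\<rbrakk> \<otimes> \<lbrakk>c, d\<rbrakk> \<oplus> \<lbrakk>u, c, a\<rbrakk> \<otimes> \<lbrakk>b, d\<rbrakk>)"
    using uc abcd by (intro eq_minusI) auto
  show ?thesis
    unfolding eq using u uc abcd
    by (intro ideal_minus[OF W] ideal_add[OF W] ideal_mult_left[OF W] ideal_mult_right[OF W]
        polarized_mem UW ideal_mult_right[OF U] commutator_closed)
qed

end

section \<open>Extending from generators to the whole ring\<close>

context
  fixes Y
  assumes Y: "Y \<subseteq> carrier R" and gen: "generate_ring R Y = carrier R"
begin

text \<open>
  Every element is a sum of words in \<open>Y\<close> up to sign. Words are built letter by letter because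
  in the arguments below more is known about a generator than the induction hypothesis says.
\<close>

lemma word_induct [consumes 1, case_names one uminus add mult]:
  assumes a: "a \<in> carrier R" and one: "P \<one>"
    and uminus: "\<And>a. \<lbrakk>a \<in> carrier R; P a\<rbrakk> \<Longrightarrow> P (\<ominus> a)"
    and add: "\<And>a b. \<lbrakk>a \<in> carrier R; b \<in> carrier R; P a; P b\<rbrakk> \<Longrightarrow> P (a \<oplus> b)"
    and mult: "\<And>x a. \<lbrakk>x \<in> Y; x \<in> carrier R; a \<in> carrier R; P a\<rbrakk> \<Longrightarrow> P (x \<otimes> a)"
  shows "P a"
proof -
  note carr = generate_ring_in_carrier[OF Y]
  have "a \<in> generate_ring R Y" using a gen by simp
  then have "\<forall>b \<in> carrier R. P b \<longrightarrow> P (a \<otimes> b)"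
  proof induction
    case (incl h)
    then show ?case using mult Y by blast
  next
    case (a_inv h)
    then show ?case using uminus carr by (simp add: l_minus)
  next
    case (eng_add h1 h2)
    then show ?case using add carr by (simp add: l_distr)
  next
    case (eng_mult h1 h2)
    then show ?case using carr by (simp add: m_assoc)
  qed simp
  then show ?thesis using one a by fastforce
qed

lemma commutator_mem_if_generators:
  assumes I: "ideal I R" and v: "v \<in> carrier R"
    and x: "\<And>x. x \<in> Y \<Longrightarrow> \<lbrakk>v, x\<rbrakk> \<in> I"
    and a: "a \<in> carrier R"
  shows "\<lbrakk>v, a\<rbrakk> \<in> I"
  using a
proof (induction rule: word_induct)
  case one
  then show ?case using v by (simp add: commutator_one_right ideal_zero[OF I])
qed (use v in \<open>simp_all add: commutator_uminus_right commutator_add_right commutator_mult_right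
      x ideal_intros[OF I]\<close>)

text \<open>
  If \<open>u\<close> and \<open>v\<close> are central modulo \<open>I\<close>, then \<open>c \<mapsto> u \<otimes> \<lbrakk>y, c\<rbrakk> \<oplus> v \<otimes> \<lbrakk>z, c\<rbrakk>\<close> is a
  derivation modulo \<open>I\<close>, so it vanishes once it vanishes on generators.
\<close>

lemma central_combination_mem_if_generators:
  assumes I: "ideal I R"
    and carr: "u \<in> carrier R" "v \<in> carrier R" "y \<in> carrier R" "z \<in> carrier R"
    and u: "\<And>a. a \<in> carrier R \<Longrightarrow> \<lbrakk>u, a\<rbrakk> \<in> I"
    and v: "\<And>a. a \<in> carrier R \<Longrightarrow> \<lbrakk>v, a\<rbrakk> \<in> I"
    and x: "\<And>x. x \<in> Y \<Longrightarrow> u \<otimes> \<lbrakk>y, x\<rbrakk> \<oplus> v \<otimes> \<lbrakk>z, x\<rbrakk> \<in> I"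
    and c: "c \<in> carrier R"
  shows "u \<otimes> \<lbrakk>y, c\<rbrakk> \<oplus> v \<otimes> \<lbrakk>z, c\<rbrakk> \<in> I"
  using c
proof (induction rule: word_induct)
  case one
  then show ?case using carr by (simp add: commutator_one_right ideal_zero[OF I])
next
  case (uminus a)
  have "u \<otimes> \<lbrakk>y, \<ominus> a\<rbrakk> \<oplus> v \<otimes> \<lbrakk>z, \<ominus> a\<rbrakk> = \<ominus> (u \<otimes> \<lbrakk>y, a\<rbrakk> \<oplus> v \<otimes> \<lbrakk>z, a\<rbrakk>)"
    using uminus(1) carr by (simp only: commutator_uminus_right) algebra
  then show ?case using uminus(2) by (simp add: ideal_uminus[OF I])
next
  case (add a b)
  have "u \<otimes> \<lbrakk>y, a \<oplus> b\<rbrakk> \<oplus> v \<otimes> \<lbrakk>z, a \<oplus> b\<rbrakk>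
      = (u \<otimes> \<lbrakk>y, a\<rbrakk> \<oplus> v \<otimes> \<lbrakk>z, a\<rbrakk>) \<oplus> (u \<otimes> \<lbrakk>y, b\<rbrakk> \<oplus> v \<otimes> \<lbrakk>z, b\<rbrakk>)"
    using add(1,2) carr by (simp only: commutator_add_right) algebra
  then show ?case using add(3,4) by (simp add: ideal_add[OF I])
next
  case (mult x a)
  have "u \<otimes> \<lbrakk>y, x \<otimes> a\<rbrakk> \<oplus> v \<otimes> \<lbrakk>z, x \<otimes> a\<rbrakk>
      = x \<otimes> (u \<otimes> \<lbrakk>y, a\<rbrakk> \<oplus> v \<otimes> \<lbrakk>z, a\<rbrakk>) \<oplus> (u \<otimes> \<lbrakk>y, x\<rbrakk> \<oplus> v \<otimes> \<lbrakk>z, x\<rbrakk>) \<otimes> a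
        \<oplus> (\<lbrakk>u, x\<rbrakk> \<otimes> \<lbrakk>y, a\<rbrakk> \<oplus> \<lbrakk>v, x\<rbrakk> \<otimes> \<lbrakk>z, a\<rbrakk>)"
    using mult(2,3) carr
    by (simp only: commutator_mult_right commutator_closed
        mult_leibniz_left[of u x a "\<lbrakk>y, a\<rbrakk>" "\<lbrakk>y, x\<rbrakk>"]
        mult_leibniz_left[of v x a "\<lbrakk>z, a\<rbrakk>" "\<lbrakk>z, x\<rbrakk>"]) algebra
  moreover have "\<dots> \<in> I"
    using mult carr x u v by (simp add: ideal_intros[OF I])
  ultimately show ?case by simp
qed

lemma polarized_mem_last:
  assumes I: "ideal I R" and s: "s \<in> carrier R"
    and central: "\<And>x y. \<lbrakk>x \<in> Y; y \<in> Y\<rbrakk> \<Longrightarrow> \<lbrakk>s, x, y\<rbrakk> \<in> I"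
    and pol: "\<And>x y z. \<lbrakk>x \<in> Y; y \<in> Y; z \<in> Y\<rbrakk> \<Longrightarrow> polarized s x y z \<in> I"
    and "x \<in> Y" "y \<in> Y" "c \<in> carrier R"
  shows "polarized s x y c \<in> I"
proof -
  have xy: "x \<in> carrier R" "y \<in> carrier R" using assms Y by auto
  have central': "\<lbrakk>s, z, a\<rbrakk> \<in> I" if "z \<in> Y" "a \<in> carrier R" for z a
    by (rule commutator_mem_if_generators[OF I]) (use that s Y central in auto)
  show ?thesis
    by (rule central_combination_mem_if_generators[OF I]) (use xy assms central' in auto)
qed

text \<open>
  The same principle in the argument \<open>a\<close> of \<open>polarized s a b c\<close>: here \<open>\<lbrakk>b, c\<rbrakk>\<close> has to
  be moved past words, which costs a term \<open>\<lbrakk>s, a\<rbrakk> \<otimes> \<lbrakk>b, c, d\<rbrakk>\<close>.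
\<close>

lemma polarized_mem_first:
  assumes I: "ideal I R"
    and carr: "s \<in> carrier R" "b \<in> carrier R" "c \<in> carrier R"
    and central: "\<And>a. a \<in> carrier R \<Longrightarrow> \<lbrakk>s, b, a\<rbrakk> \<in> I"
    and triple: "\<And>a d. \<lbrakk>a \<in> carrier R; d \<in> carrier R\<rbrakk> \<Longrightarrow> \<lbrakk>s, a\<rbrakk> \<otimes> \<lbrakk>b, c, d\<rbrakk> \<in> I"
    and x: "\<And>x. x \<in> Y \<Longrightarrow> polarized s x b c \<in> I"
    and a: "a \<in> carrier R"
  shows "polarized s a b c \<in> I"
  using a
proof (induction rule: word_induct)
  case one
  then show ?case
    using carr by (simp add: commutator_one_right commutator_one_left ideal_zero[OF I])
next
  case (uminus a)
  have "polarized s (\<ominus> a) b c = \<ominus> polarized s a b c"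
    using uminus(1) carr by (simp only: commutator_uminus_right commutator_uminus_left) algebra
  then show ?case using uminus(2) by (simp add: ideal_uminus[OF I])
next
  case (add a d)
  have "polarized s (a \<oplus> d) b c = polarized s a b c \<oplus> polarized s d b c"
    using add(1,2) carr by (simp only: commutator_add_right commutator_add_left) algebra
  then show ?case using add(3,4) by (simp add: ideal_add[OF I])
next
  case (mult x a)
  have "polarized s (x \<otimes> a) b c
      = x \<otimes> polarized s a b c \<oplus> polarized s x b c \<otimes> a
        \<oplus> (\<lbrakk>s, b, x\<rbrakk> \<otimes> \<lbrakk>a, c\<rbrakk> \<ominus> \<lbrakk>s, x\<rbrakk> \<otimes> \<lbrakk>b, c, a\<rbrakk>)"
    using mult(2,3) carr
    by (simp only: commutator_mult_right commutator_mult_left commutator_closed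
        mult_leibniz_left[of "\<lbrakk>s, b\<rbrakk>" x a "\<lbrakk>a, c\<rbrakk>" "\<lbrakk>x, c\<rbrakk>"]
        mult_leibniz_right[of "\<lbrakk>b, c\<rbrakk>" x a "\<lbrakk>s, a\<rbrakk>" "\<lbrakk>s, x\<rbrakk>"]) algebra
  moreover have "\<dots> \<in> I"
    using mult carr by (simp add: ideal_intros[OF I] central x triple)
  ultimately show ?case by simp
qed

text \<open>
  Expanding \<open>\<lbrakk>s, x \<otimes> a, c\<rbrakk>\<close> leaves the mixed terms \<open>\<lbrakk>x, c\<rbrakk> \<otimes> \<lbrakk>s, a\<rbrakk> \<oplus> \<lbrakk>s, x\<rbrakk> \<otimes> \<lbrakk>a, c\<rbrakk>\<close>. As \<open>\<lbrakk>s, a\<rbrakk>\<close> is central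
  by induction, they amount to \<open>polarized s x a c\<close>.
\<close>

lemma commutator_central_if_polarized:
  assumes I: "ideal I R" and s: "s \<in> carrier R"
    and central: "\<And>x a. \<lbrakk>x \<in> Y; a \<in> carrier R\<rbrakk> \<Longrightarrow> \<lbrakk>s, x, a\<rbrakk> \<in> I"
    and pol: "\<And>x b c. \<lbrakk>x \<in> Y; b \<in> carrier R; c \<in> carrier R\<rbrakk> \<Longrightarrow> polarized s x b c \<in> I"
    and a: "a \<in> carrier R" and c: "c \<in> carrier R"
  shows "\<lbrakk>s, a, c\<rbrakk> \<in> I"
  using a c
proof (induction arbitrary: c rule: word_induct)
  case one
  then show ?case
    using s by (simp add: commutator_one_right commutator_zero_left ideal_zero[OF I])
next
  case (mult x a)
  have "\<lbrakk>x, c\<rbrakk> \<otimes> \<lbrakk>s, a\<rbrakk> = \<lbrakk>s, a\<rbrakk> \<otimes> \<lbrakk>x, c\<rbrakk> \<ominus> \<lbrakk>s, a, \<lbrakk>x, c\<rbrakk>\<rbrakk>"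
    using mult s by (intro eq_minusI mult_eq_swap_add_commutator) auto
  then have "\<lbrakk>s, x \<otimes> a, c\<rbrakk> = x \<otimes> \<lbrakk>s, a, c\<rbrakk> \<oplus> polarized s x a c
      \<ominus> \<lbrakk>s, a, \<lbrakk>x, c\<rbrakk>\<rbrakk> \<oplus> \<lbrakk>s, x, c\<rbrakk> \<otimes> a"
    using mult(2,3,5) s
    by (simp only: commutator_mult_right commutator_mult_left commutator_add_left
        commutator_closed m_closed) algebra
  moreover have "\<dots> \<in> I"
    using mult s by (simp add: ideal_intros[OF I] central pol)
  ultimately show ?case by simp
qed (use s in \<open>simp_all add: commutator_uminus_right commutator_add_right commutator_uminus_left
      commutator_add_left ideal_intros[OF I]\<close>)

text \<open>
  The two conclusions have to be reached in a fixed order: \<open>polarized s x y c\<close> is extended first in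
  its last argument, where the coefficients \<open>\<lbrakk>s, x\<rbrakk>\<close> and \<open>\<lbrakk>s, y\<rbrakk>\<close> are already central, and then in
  one of its symmetric arguments; this much suffices for the centrality of all \<open>\<lbrakk>s, a\<rbrakk>\<close>.
\<close>

lemma
  assumes I: "ideal I R" and s: "s \<in> carrier R"
    and central: "\<And>x y. \<lbrakk>x \<in> Y; y \<in> Y\<rbrakk> \<Longrightarrow> \<lbrakk>s, x, y\<rbrakk> \<in> I"
    and pol: "\<And>x y z. \<lbrakk>x \<in> Y; y \<in> Y; z \<in> Y\<rbrakk> \<Longrightarrow> polarized s x y z \<in> I"
    and triple: "\<And>x b c d. \<lbrakk>x \<in> Y; b \<in> carrier R; c \<in> carrier R; d \<in> carrier R\<rbrakk>
      \<Longrightarrow> \<lbrakk>s, b\<rbrakk> \<otimes> \<lbrakk>x, c, d\<rbrakk> \<in> I"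
  shows polarized_mem_generator:
      "\<lbrakk>x \<in> Y; b \<in> carrier R; c \<in> carrier R\<rbrakk> \<Longrightarrow> polarized s x b c \<in> I"
    and commutator_central:
      "\<lbrakk>a \<in> carrier R; c \<in> carrier R\<rbrakk> \<Longrightarrow> \<lbrakk>s, a, c\<rbrakk> \<in> I"
proof -
  have central': "\<lbrakk>s, x, a\<rbrakk> \<in> I" if "x \<in> Y" "a \<in> carrier R" for x a
    by (rule commutator_mem_if_generators[OF I]) (use that s central Y in auto)
  have pol': "polarized s x b c \<in> I" if "x \<in> Y" "b \<in> carrier R" "c \<in> carrier R" for x b c
  proof -
    have xc: "x \<in> carrier R" using that Y by auto
    have "polarized s y x c \<in> I" if "y \<in> Y" for y
      by (rule polarized_mem_last[OF I s central pol]) (use that \<open>x \<in> Y\<close> \<open>c \<in> carrier R\<close> in auto)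
    then have "polarized s b x c \<in> I"
      by (intro polarized_mem_first[OF I, of s x c b]) (use that xc s central' triple in auto)
    then show ?thesis
      using that xc s a_comm[of "\<lbrakk>s, b\<rbrakk> \<otimes> \<lbrakk>x, c\<rbrakk>"] by simp
  qed
  show "polarized s x b c \<in> I" if "x \<in> Y" "b \<in> carrier R" "c \<in> carrier R"
    using that by (rule pol')
  show "\<lbrakk>s, a, c\<rbrakk> \<in> I" if "a \<in> carrier R" "c \<in> carrier R"
    using that central' pol' by (rule commutator_central_if_polarized[OF I s, rotated 2])
qed

text \<open>
  The classical description of the ideal of an algebra that is generated by all triple commutators.
  For a generator \<open>x\<close>, the mixed terms in \<open>\<lbrakk>x, y \<otimes> a, z\<rbrakk>\<close> form \<open>polarized y z x a\<close>, with the arbitrary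
  element in last position, so that \<open>\<lbrakk>x, a\<rbrakk>\<close> is central for all \<open>a\<close>. This provides the
  hypotheses on \<open>s\<close> of the preceding lemma for an arbitrary element in place of \<open>s\<close>.
\<close>

lemma commutator3_mem_if_generators:
  assumes J: "ideal J R"
    and central: "\<And>x y z. \<lbrakk>x \<in> Y; y \<in> Y; z \<in> Y\<rbrakk> \<Longrightarrow> \<lbrakk>x, y, z\<rbrakk> \<in> J"
    and pol: "\<And>w x y z. \<lbrakk>w \<in> Y; x \<in> Y; y \<in> Y; z \<in> Y\<rbrakk> \<Longrightarrow> polarized w x y z \<in> J"
    and abc: "a \<in> carrier R" "b \<in> carrier R" "c \<in> carrier R"
  shows "\<lbrakk>a, b, c\<rbrakk> \<in> J"
proof -
  have carr: "x \<in> carrier R" if "x \<in> Y" for x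
    using that Y by auto
  have pol': "polarized x y z a \<in> J"
    if "x \<in> Y" "y \<in> Y" "z \<in> Y" "a \<in> carrier R" for x y z a
    by (rule polarized_mem_last[OF J]) (use that central pol carr in auto)
  have gen_central_gen: "\<lbrakk>x, a, z\<rbrakk> \<in> J" if "a \<in> carrier R" "x \<in> Y" "z \<in> Y" for x a z
    using that
  proof (induction rule: word_induct)
    case one
    then show ?case
      using carr by (simp add: commutator_one_right commutator_zero_left ideal_zero[OF J])
  next
    case (mult y a)
    have swap: "\<lbrakk>x, y\<rbrakk> \<otimes> \<lbrakk>a, z\<rbrakk> = \<lbrakk>y, x\<rbrakk> \<otimes> \<lbrakk>z, a\<rbrakk>"
      using mult carr commutator_swap[of x y] commutator_swap[of a z] by (simp add: l_minus r_minus)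
    have "\<lbrakk>x, y \<otimes> a, z\<rbrakk> = y \<otimes> \<lbrakk>x, a, z\<rbrakk> \<oplus> polarized y z x a \<oplus> \<lbrakk>x, y, z\<rbrakk> \<otimes> a"
      using mult(2,3) carr[OF mult(5)] carr[OF mult(6)]
      by (simp only: commutator_mult_right commutator_mult_left commutator_add_left
          commutator_closed m_closed swap) algebra
    moreover have "\<dots> \<in> J"
      using mult by (simp add: ideal_intros[OF J] central pol')
    ultimately show ?case by simp
  qed (use carr in \<open>simp_all add: commutator_uminus_right commutator_add_right
      commutator_uminus_left commutator_add_left ideal_intros[OF J]\<close>)
  have gen_central: "\<lbrakk>x, a, b\<rbrakk> \<in> J" if "x \<in> Y" "a \<in> carrier R" "b \<in> carrier R" for x a b
    by (rule commutator_mem_if_generators[OF J]) (use that carr gen_central_gen in auto)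
  have central': "\<lbrakk>a, x, y\<rbrakk> \<in> J" if "x \<in> Y" "y \<in> carrier R" for x y
  proof -
    have "\<lbrakk>a, x, y\<rbrakk> = \<ominus> \<lbrakk>x, a, y\<rbrakk>"
      using that abc carr commutator_swap[of a x] by (simp add: commutator_uminus_left)
    then show ?thesis using gen_central that abc by (simp add: ideal_uminus[OF J])
  qed
  have pol_a: "polarized a x y z \<in> J" if "x \<in> Y" "y \<in> Y" "z \<in> Y" for x y z
  proof -
    have "\<lbrakk>a, x\<rbrakk> \<otimes> \<lbrakk>y, z\<rbrakk> = \<lbrakk>z, y\<rbrakk> \<otimes> \<lbrakk>x, a\<rbrakk> \<oplus> \<lbrakk>x, a, \<lbrakk>z, y\<rbrakk>\<rbrakk>"
      "\<lbrakk>a, y\<rbrakk> \<otimes> \<lbrakk>x, z\<rbrakk> = \<lbrakk>z, x\<rbrakk> \<otimes> \<lbrakk>y, a\<rbrakk> \<oplus> \<lbrakk>y, a, \<lbrakk>z, x\<rbrakk>\<rbrakk>"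
      using that[THEN carr] abc commutator_swap[of a x] commutator_swap[of y z]
        commutator_swap[of a y] commutator_swap[of x z]
        mult_eq_swap_add_commutator[of "\<lbrakk>x, a\<rbrakk>" "\<lbrakk>z, y\<rbrakk>"]
        mult_eq_swap_add_commutator[of "\<lbrakk>y, a\<rbrakk>" "\<lbrakk>z, x\<rbrakk>"]
      by (simp_all add: l_minus r_minus)
    then have "polarized a x y z
        = polarized z y x a \<oplus> (\<lbrakk>x, a, \<lbrakk>z, y\<rbrakk>\<rbrakk> \<oplus> \<lbrakk>y, a, \<lbrakk>z, x\<rbrakk>\<rbrakk>)"
      using that[THEN carr] abc by (simp only:) algebra
    moreover have "\<dots> \<in> J"
      using that that[THEN carr] abc
      by (intro ideal_add[OF J] gen_central pol' commutator_closed)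
    ultimately show ?thesis by simp
  qed
  show ?thesis
    by (rule commutator_central[OF J _ central' pol_a])
      (use abc carr gen_central in \<open>auto intro: ideal_mult_left[OF J]\<close>)
qed

end

section \<open>Products of commutators of generators\<close>

context
  fixes I and s and Y
  assumes I: "ideal I R" and s: "s \<in> carrier R" and Y: "Y \<subseteq> carrier R"
    and central: "\<And>x a. \<lbrakk>x \<in> Y; a \<in> carrier R\<rbrakk> \<Longrightarrow> \<lbrakk>s, x, a\<rbrakk> \<in> I"
    and pol: "\<And>x y z. \<lbrakk>x \<in> Y; y \<in> Y; z \<in> Y\<rbrakk> \<Longrightarrow> polarized s x y z \<in> I"
begin

text \<open>
  Let \<open>f x y z w = \<lbrakk>s, x\<rbrakk> \<otimes> \<lbrakk>y, z, w\<rbrakk>\<close>. Bracketing \<open>polarized s x y z\<close> with \<open>w\<close> shows that \<open>f\<close> is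
  alternating in its first three arguments modulo \<open>I\<close>. So on four given generators it has, up to
  sign, four values, according to which generator comes last. The Jacobi identity in the last three
  arguments, with each of the generators in first place, gives four linear relations between
  these values, and together they imply that three times each value vanishes. This is
  where \<open>3\<close> must be invertible.
\<close>

lemma commutator_mult_commutator3_mem:
  assumes three: "\<And>a. \<lbrakk>a \<in> carrier R; a \<oplus> a \<oplus> a \<in> I\<rbrakk> \<Longrightarrow> a \<in> I"
    and abcd: "a \<in> Y" "b \<in> Y" "c \<in> Y" "d \<in> Y"
  shows "\<lbrakk>s, a\<rbrakk> \<otimes> \<lbrakk>b, c, d\<rbrakk> \<in> I"
proof -
  define f where "f x y z w = \<lbrakk>s, x\<rbrakk> \<otimes> \<lbrakk>y, z, w\<rbrakk>" for x y z w
  have carr: "x \<in> carrier R" if "x \<in> Y" for x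
    using that Y by auto
  have f_closed: "f x y z w \<in> carrier R" if "x \<in> Y" "y \<in> Y" "z \<in> Y" "w \<in> Y" for x y z w
    using that carr s by (simp add: f_def)
  have swap12: "f x y z w \<oplus> f y x z w \<in> I" if xyzw: "x \<in> Y" "y \<in> Y" "z \<in> Y" "w \<in> Y" for x y z w
  proof -
    note xyzw_carr = xyzw[THEN carr]
    have "f x y z w \<oplus> f y x z w = \<lbrakk>polarized s x y z, w\<rbrakk>
        \<ominus> (\<lbrakk>s, x, w\<rbrakk> \<otimes> \<lbrakk>y, z\<rbrakk> \<oplus> \<lbrakk>s, y, w\<rbrakk> \<otimes> \<lbrakk>x, z\<rbrakk>)"
      unfolding f_def using s xyzw_carr
      by (simp only: commutator_mult_left commutator_add_left commutator_closed m_closed) algebra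
    moreover have "\<dots> \<in> I"
      using s xyzw xyzw_carr
      by (simp add: ideal_commutator_left[OF I] pol central ideal_intros[OF I])
    ultimately show ?thesis by simp
  qed
  have swap23: "f x z y w = \<ominus> f x y z w" if xyzw: "x \<in> Y" "y \<in> Y" "z \<in> Y" "w \<in> Y" for x y z w
    using s xyzw[THEN carr] commutator_swap[of z y]
    by (simp add: f_def commutator_uminus_left r_minus)
  have jac: "f x y z w \<oplus> f x z w y \<ominus> f x y w z = \<zero>"
    if xyzw: "x \<in> Y" "y \<in> Y" "z \<in> Y" "w \<in> Y" for x y z w
  proof -
    note xyzw_carr = xyzw[THEN carr]
    have "f x y z w \<oplus> f x z w y \<ominus> f x y w z = \<lbrakk>s, x\<rbrakk> \<otimes> (\<lbrakk>y, z, w\<rbrakk> \<oplus> \<lbrakk>z, w, y\<rbrakk> \<ominus> \<lbrakk>y, w, z\<rbrakk>)"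
      unfolding f_def using s xyzw_carr by algebra
    then show ?thesis
      using s xyzw_carr by (simp add: jacobi)
  qed
  define p q r t where "p = f a b c d" and "q = f b c d a" and "r = f a c d b" and "t = f a b d c"
  note defs = p_def q_def r_def t_def
  have pqrt: "p \<in> carrier R" "q \<in> carrier R" "r \<in> carrier R" "t \<in> carrier R"
    using abcd by (simp_all add: defs f_closed)
  have ja: "p \<oplus> r \<ominus> t = \<zero>"
    unfolding defs using abcd by (intro jac)
  have jb: "p \<ominus> q \<ominus> t \<in> I"
  proof -
    have "p \<ominus> q \<ominus> t = (f a b c d \<oplus> f b a c d) \<ominus> (f a b d c \<oplus> f b a d c)
        \<ominus> (f b a c d \<oplus> f b c d a \<ominus> f b a d c)"
      unfolding defs using f_closed abcd by algebra
    then show ?thesis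
      using abcd by (simp add: jac swap12 ideal_intros[OF I])
  qed
  have jc: "p \<ominus> q \<oplus> r \<in> I"
  proof -
    have "p \<ominus> q \<oplus> r = (f c a b d \<oplus> f c b d a \<ominus> f c a d b)
        \<ominus> (f a c b d \<oplus> f c a b d) \<ominus> (f b c d a \<oplus> f c b d a) \<oplus> (f a c d b \<oplus> f c a d b)"
      unfolding defs swap23[OF abcd(1,2,3,4)] using f_closed abcd by algebra
    then show ?thesis
      using abcd by (simp add: jac swap12 ideal_intros[OF I])
  qed
  have jd: "t \<oplus> q \<ominus> r \<in> I"
  proof -
    have "t \<oplus> q \<ominus> r = (f d a b c \<oplus> f d b c a \<ominus> f d a c b)
        \<ominus> (f a d b c \<oplus> f d a b c) \<ominus> (f b d c a \<oplus> f d b c a) \<oplus> (f a d c b \<oplus> f d a c b)"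
      unfolding defs swap23[OF abcd(1,2,4,3)] swap23[OF abcd(2,3,4,1)] swap23[OF abcd(1,3,4,2)]
      using f_closed abcd by algebra
    then show ?thesis
      using abcd by (simp add: jac swap12 ideal_intros[OF I])
  qed
  (* With the signs of the alternating f, the four relations read p = t - r, p = q + t, p = q - r
     and t + q = r, so that 3 p = 2 (q - r + t) = 0. *)
  have "p \<oplus> p \<oplus> p = (p \<oplus> r \<ominus> t) \<oplus> (p \<ominus> q \<ominus> t) \<oplus> (p \<ominus> q \<oplus> r)
      \<oplus> (t \<oplus> q \<ominus> r) \<oplus> (t \<oplus> q \<ominus> r)"
    using pqrt by algebra
  also have "\<dots> \<in> I"
    unfolding ja using jb jc jd by (simp add: ideal_add[OF I] ideal_zero[OF I])
  finally show ?thesis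
    using three[OF pqrt(1)] by (simp add: p_def f_def)
qed

text \<open>
  The product \<open>g v x y z w = \<lbrakk>s, v\<rbrakk> \<otimes> (\<lbrakk>x, y\<rbrakk> \<otimes> \<lbrakk>z, w\<rbrakk>)\<close> is alternating in \<open>v\<close>, \<open>x\<close>, \<open>y\<close> modulo \<open>I\<close>.
  As \<open>\<lbrakk>s, v\<rbrakk>\<close> annihilates triple commutators of generators, the last two factors may be exchanged, so
  \<open>g\<close> is alternating in \<open>v\<close>, \<open>z\<close>, \<open>w\<close> as well, hence in all five arguments. The assertion is the sign
  change under the exchange of \<open>b\<close> and \<open>c\<close>.
\<close>

lemma commutator_mult_polarized_mem:
  assumes triple: "\<And>a b c d. \<lbrakk>a \<in> Y; b \<in> Y; c \<in> Y; d \<in> Y\<rbrakk> \<Longrightarrow> \<lbrakk>s, a\<rbrakk> \<otimes> \<lbrakk>b, c, d\<rbrakk> \<in> I"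
    and yabcd: "y \<in> Y" "a \<in> Y" "b \<in> Y" "c \<in> Y" "d \<in> Y"
  shows "\<lbrakk>s, y\<rbrakk> \<otimes> polarized a b c d \<in> I"
proof -
  define g where "g v x y z w = \<lbrakk>s, v\<rbrakk> \<otimes> (\<lbrakk>x, y\<rbrakk> \<otimes> \<lbrakk>z, w\<rbrakk>)" for v x y z w
  have carr: "x \<in> carrier R" if "x \<in> Y" for x
    using that Y by auto
  have g_closed: "g v x y z w \<in> carrier R"
    if "v \<in> Y" "x \<in> Y" "y \<in> Y" "z \<in> Y" "w \<in> Y" for v x y z w
    using that carr s by (simp add: g_def)
  have swap12: "g v x y z w \<oplus> g x v y z w \<in> I"
    if vxyzw: "v \<in> Y" "x \<in> Y" "y \<in> Y" "z \<in> Y" "w \<in> Y" for v x y z w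
  proof -
    have "g v x y z w \<oplus> g x v y z w = polarized s v x y \<otimes> \<lbrakk>z, w\<rbrakk>"
      unfolding g_def using s vxyzw[THEN carr] by algebra
    then show ?thesis
      using vxyzw carr by (simp add: pol ideal_mult_right[OF I])
  qed
  have swap23: "g v y x z w = \<ominus> g v x y z w"
    if vxyzw: "v \<in> Y" "x \<in> Y" "y \<in> Y" "z \<in> Y" "w \<in> Y" for v x y z w
    using s vxyzw[THEN carr] commutator_swap[of y x] by (simp add: g_def l_minus r_minus)
  have swap_pairs: "g v x y z w \<ominus> g v z w x y \<in> I"
    if vxyzw: "v \<in> Y" "x \<in> Y" "y \<in> Y" "z \<in> Y" "w \<in> Y" for v x y z w
  proof -
    have q: "\<lbrakk>s, v\<rbrakk> \<otimes> \<lbrakk>q, u\<rbrakk> \<in> I" if "q \<in> carrier R" "u \<in> Y" "\<lbrakk>s, v\<rbrakk> \<otimes> q \<in> I" for q u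
    proof -
      have "\<lbrakk>s, v\<rbrakk> \<otimes> \<lbrakk>q, u\<rbrakk> = \<lbrakk>\<lbrakk>s, v\<rbrakk> \<otimes> q, u\<rbrakk> \<ominus> \<lbrakk>s, v, u\<rbrakk> \<otimes> q"
        using s vxyzw[THEN carr] carr[OF that(2)] that(1)
        by (simp only: commutator_mult_left commutator_closed) algebra
      then show ?thesis
        using that carr vxyzw
        by (simp add: ideal_commutator_left[OF I] central ideal_intros[OF I])
    qed
    have "g v x y z w \<ominus> g v z w x y = \<lbrakk>s, v\<rbrakk> \<otimes> \<lbrakk>\<lbrakk>x, y\<rbrakk>, \<lbrakk>z, w\<rbrakk>\<rbrakk>"
      unfolding g_def commutator_def[of R "\<lbrakk>x, y\<rbrakk>"] using s vxyzw[THEN carr] by algebra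
    also have "\<dots> = \<lbrakk>s, v\<rbrakk> \<otimes> \<lbrakk>\<lbrakk>x, y\<rbrakk>, z, w\<rbrakk> \<ominus> \<lbrakk>s, v\<rbrakk> \<otimes> \<lbrakk>\<lbrakk>x, y\<rbrakk>, w, z\<rbrakk>"
      using s vxyzw[THEN carr] by (simp only: commutator_of_commutator commutator_closed) algebra
    also have "\<dots> \<in> I"
      using vxyzw carr by (intro ideal_minus[OF I]; intro q[OF _ _ triple]) auto
    finally show ?thesis .
  qed
  note swaps = swap23[OF yabcd(1,3,2,4,5)] swap23[OF yabcd(1,4,2,3,5)]
  have "\<lbrakk>s, y\<rbrakk> \<otimes> polarized a b c d = g y a b c d \<oplus> g y a c b d"
    unfolding g_def using s yabcd[THEN carr] by algebra
  also have "\<dots> = (g b y a c d \<ominus> g b c d y a) \<oplus> (g b c d y a \<oplus> g c b d y a)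
      \<ominus> (g y b a c d \<oplus> g b y a c d) \<ominus> (g c b d y a \<ominus> g c y a b d)
      \<ominus> (g c y a b d \<oplus> g y c a b d)"
    unfolding swaps using g_closed yabcd by algebra
  also have "\<dots> \<in> I"
    using yabcd by (simp add: swap12 swap_pairs ideal_add[OF I] ideal_minus[OF I])
  finally show ?thesis .
qed

end

section \<open>The four families generate the ideal\<close>

text \<open>The ideal quotient \<open>I : U\<close>, with \<open>U\<close> as the left factor.\<close>

definition residual :: "'a set \<Rightarrow> 'a set \<Rightarrow> 'a set"
  where "residual I U = {q \<in> carrier R. \<forall>u \<in> U. u \<otimes> q \<in> I}"

lemma ideal_residual:
  assumes I: "ideal I R" and U: "ideal U R"
  shows "ideal (residual I U) R"
proof (rule idealI_closed)
  have carr: "u \<in> carrier R" if "u \<in> U" for u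
    using ideal.Icarr[OF U that] .
  show "residual I U \<subseteq> carrier R" "\<zero> \<in> residual I U"
    using carr ideal_zero[OF I] by (auto simp: residual_def)
  show "a \<oplus> b \<in> residual I U" if "a \<in> residual I U" "b \<in> residual I U" for a b
    using that carr ideal_add[OF I] by (auto simp: residual_def r_distr)
  show "x \<otimes> a \<in> residual I U" if "x \<in> carrier R" "a \<in> residual I U" for x a
    using that carr ideal_mult_right[OF U] by (auto simp: residual_def simp flip: m_assoc)
  show "a \<otimes> x \<in> residual I U" if "x \<in> carrier R" "a \<in> residual I U" for x a
    using that carr ideal_mult_right[OF I] by (auto simp: residual_def simp flip: m_assoc)
qed

context
  fixes I and S and Y
  assumes I: "ideal I R" and S: "S \<subseteq> carrier R"
    and Y: "Y \<subseteq> carrier R" and gen: "generate_ring R Y = carrier R"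
    and central: "\<And>s x y. \<lbrakk>s \<in> S; x \<in> Y; y \<in> Y\<rbrakk> \<Longrightarrow> \<lbrakk>s, x, y\<rbrakk> \<in> I"
begin

lemma generator_carr: "s \<in> S \<Longrightarrow> s \<in> carrier R" "x \<in> Y \<Longrightarrow> x \<in> carrier R"
  using S Y by auto

lemma commutator_generators_central:
  "\<lbrakk>s \<in> S; x \<in> Y; a \<in> carrier R\<rbrakk> \<Longrightarrow> \<lbrakk>s, x, a\<rbrakk> \<in> I"
  by (rule commutator_mem_if_generators[OF Y gen I]) (auto simp: generator_carr central)

text \<open>
  To place \<open>u \<otimes> q\<close> in \<open>I\<close> for all \<open>u\<close> in the ideal generated by \<open>S\<close>, one must control \<open>s \<otimes> c \<otimes> q\<close> for
  words \<open>c\<close>. Moving the letters \<open>x\<close> of \<open>c\<close> in front of \<open>s\<close> produces the central elements \<open>\<lbrakk>s, x\<rbrakk>\<close>,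
  which then move on until they meet \<open>q\<close>.
\<close>

lemma mem_residual_if_generators:
  assumes q: "q \<in> carrier R"
    and sq: "\<And>s. s \<in> S \<Longrightarrow> s \<otimes> q \<in> I"
    and sxq: "\<And>s x. \<lbrakk>s \<in> S; x \<in> Y\<rbrakk> \<Longrightarrow> \<lbrakk>s, x\<rbrakk> \<otimes> q \<in> I"
  shows "q \<in> residual I (Idl S)"
proof -
  have scq: "s \<otimes> c \<otimes> q \<in> I" if s: "s \<in> S" and c: "c \<in> carrier R" for s c
    using c
  proof (induction rule: word_induct[OF Y gen, consumes 1, case_names one uminus add mult])
    case one
    then show ?case using s sq generator_carr by simp
  next
    case (uminus a)
    then show ?case using s q generator_carr by (simp add: l_minus r_minus ideal_uminus[OF I])
  next
    case (add a b)
    then show ?case using s q generator_carr by (simp add: l_distr r_distr ideal_add[OF I])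
  next
    case (mult x a)
    have sc: "s \<in> carrier R" using s generator_carr by blast
    have "s \<otimes> (x \<otimes> a) \<otimes> q = x \<otimes> (s \<otimes> a \<otimes> q) \<oplus> \<lbrakk>s, x\<rbrakk> \<otimes> a \<otimes> q"
      using sc mult(2,3) q unfolding commutator_def by algebra
    also have "\<lbrakk>s, x\<rbrakk> \<otimes> a = a \<otimes> \<lbrakk>s, x\<rbrakk> \<oplus> \<lbrakk>s, x, a\<rbrakk>"
      using sc mult(2,3) by (intro mult_eq_swap_add_commutator) auto
    finally have "s \<otimes> (x \<otimes> a) \<otimes> q
        = x \<otimes> (s \<otimes> a \<otimes> q) \<oplus> (a \<otimes> (\<lbrakk>s, x\<rbrakk> \<otimes> q) \<oplus> \<lbrakk>s, x, a\<rbrakk> \<otimes> q)"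
      using sc mult(2,3) q by (simp add: l_distr m_assoc)
    moreover have "\<dots> \<in> I"
      using s mult q by (simp add: commutator_generators_central sxq ideal_intros[OF I])
    ultimately show ?case by simp
  qed
  let ?J = "{u \<in> carrier R. \<forall>c \<in> carrier R. u \<otimes> c \<otimes> q \<in> I}"
  have "ideal ?J R"
  proof (rule idealI_closed)
    show "x \<otimes> a \<in> ?J" if "x \<in> carrier R" "a \<in> ?J" for x a
      using that q by (auto simp: m_assoc[of x a] m_assoc[of x "a \<otimes> _" q] ideal_mult_left[OF I])
    show "a \<otimes> x \<in> ?J" if "x \<in> carrier R" "a \<in> ?J" for x a
      using that q by (auto simp: m_assoc[of a x])
  qed (use q in \<open>auto simp: ideal_zero[OF I] l_distr ideal_add[OF I]\<close>)
  then have "Idl S \<subseteq> ?J"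
    using scq generator_carr by (intro genideal_minimal) auto
  then have "u \<otimes> \<one> \<otimes> q \<in> I" "u \<in> carrier R" if "u \<in> Idl S" for u
    using that by auto
  then show ?thesis
    using q by (simp add: residual_def)
qed

text \<open>
  The elements that \<open>U = Idl S\<close> multiplies into \<open>I\<close> form an ideal, and it contains the generators
  of the ideal of all triple commutators. So \<open>U\<close> multiplies every triple commutator into \<open>I\<close>,
  which is the hypothesis under which \<open>\<lbrakk>s, a\<rbrakk>\<close> is central and \<open>polarized s a b c\<close> vanishes modulo \<open>I\<close>
  for arbitrary arguments.
\<close>

lemma commutator3_mem_if_families:
  assumes three: "\<And>a. \<lbrakk>a \<in> carrier R; a \<oplus> a \<oplus> a \<in> I\<rbrakk> \<Longrightarrow> a \<in> I"
    and triple: "\<And>s x y z. \<lbrakk>s \<in> S; x \<in> Y; y \<in> Y; z \<in> Y\<rbrakk> \<Longrightarrow> s \<otimes> \<lbrakk>x, y, z\<rbrakk> \<in> I"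
    and pol: "\<And>s x y z. \<lbrakk>s \<in> S; x \<in> Y; y \<in> Y; z \<in> Y\<rbrakk> \<Longrightarrow> polarized s x y z \<in> I"
    and mult_pol: "\<And>s w x y z. \<lbrakk>s \<in> S; w \<in> Y; x \<in> Y; y \<in> Y; z \<in> Y\<rbrakk>
      \<Longrightarrow> s \<otimes> polarized w x y z \<in> I"
    and u: "u \<in> Idl S" and b: "b \<in> carrier R" and c: "c \<in> carrier R"
  shows "\<lbrakk>u, b, c\<rbrakk> \<in> I"
proof -
  let ?J = "residual I (Idl S)"
  have IdlS: "ideal (Idl S) R"
    using S by (rule genideal_ideal)
  have S_sub: "s \<in> Idl S" if "s \<in> S" for s
    using that genideal_self[OF S] by blast
  have J: "ideal ?J R"
    using I IdlS by (rule ideal_residual)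
  have J_mult: "v \<otimes> q \<in> I" if "q \<in> ?J" "v \<in> Idl S" for v q
    using that by (simp add: residual_def)
  have sx_triple: "\<lbrakk>s, w\<rbrakk> \<otimes> \<lbrakk>x, y, z\<rbrakk> \<in> I"
    if "s \<in> S" "w \<in> Y" "x \<in> Y" "y \<in> Y" "z \<in> Y" for s w x y z
    by (rule commutator_mult_commutator3_mem[OF I _ Y _ _ three])
      (use that generator_carr commutator_generators_central pol in auto)
  have sx_pol: "\<lbrakk>s, v\<rbrakk> \<otimes> polarized w x y z \<in> I"
    if "s \<in> S" "v \<in> Y" "w \<in> Y" "x \<in> Y" "y \<in> Y" "z \<in> Y" for s v w x y z
    by (rule commutator_mult_polarized_mem[OF I _ Y])
      (use that generator_carr commutator_generators_central pol sx_triple in auto)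
  have J_triple: "\<lbrakk>x, y, z\<rbrakk> \<in> ?J"
    if "x \<in> carrier R" "y \<in> carrier R" "z \<in> carrier R" for x y z
  proof (rule commutator3_mem_if_generators[OF Y gen J _ _ that])
    show "\<lbrakk>x, y, z\<rbrakk> \<in> ?J" if "x \<in> Y" "y \<in> Y" "z \<in> Y" for x y z
      by (rule mem_residual_if_generators)
        (use that generator_carr triple sx_triple in auto)
    show "polarized w x y z \<in> ?J" if "w \<in> Y" "x \<in> Y" "y \<in> Y" "z \<in> Y" for w x y z
      by (rule mem_residual_if_generators)
        (use that generator_carr mult_pol sx_pol in auto)
  qed
  have U_triple: "\<lbrakk>v, a\<rbrakk> \<otimes> \<lbrakk>x, y, z\<rbrakk> \<in> I"
    if "v \<in> Idl S" "a \<in> carrier R" "x \<in> carrier R" "y \<in> carrier R" "z \<in> carrier R" for v a x y z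
    by (intro J_mult J_triple ideal_commutator_left[OF IdlS]) (use that in auto)
  have s_central: "\<lbrakk>s, a, d\<rbrakk> \<in> I" if "s \<in> S" "a \<in> carrier R" "d \<in> carrier R" for s a d
    by (rule commutator_central[OF Y gen I])
      (use that generator_carr central pol U_triple S_sub in auto)
  have s_pol_generator: "polarized s x a d \<in> I"
    if "s \<in> S" "x \<in> Y" "a \<in> carrier R" "d \<in> carrier R" for s x a d
    by (rule polarized_mem_generator[OF Y gen I])
      (use that generator_carr central pol U_triple S_sub in auto)
  have s_pol: "polarized s a d e \<in> I"
    if "s \<in> S" "a \<in> carrier R" "d \<in> carrier R" "e \<in> carrier R" for s a d e
    by (rule polarized_mem_first[OF Y gen I])
      (use that generator_carr s_central s_pol_generator U_triple S_sub in auto)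
  (* The elements u whose commutators are central modulo I need not form an ideal, but those v
     for which this holds for every multiple d v do: v x is handled by
     d v x = [d v, x] + x d v, where [d v, x] is central. *)
  let ?V = "{v \<in> carrier R. \<forall>d \<in> carrier R. \<forall>b \<in> carrier R. \<forall>c \<in> carrier R. \<lbrakk>d \<otimes> v, b, c\<rbrakk> \<in> I}"
  have "S \<subseteq> ?V"
  proof
    fix s assume s: "s \<in> S"
    then have sc: "s \<in> carrier R" using generator_carr by blast
    have "\<lbrakk>d \<otimes> s, b, c\<rbrakk> \<in> I" if "d \<in> carrier R" "b \<in> carrier R" "c \<in> carrier R" for d b c
    proof -
      have "\<lbrakk>s, \<lbrakk>d, b, c\<rbrakk>\<rbrakk> \<in> I"
        using that s sc
        by (simp add: commutator_of_commutator[of s "\<lbrakk>d, b\<rbrakk>" c] s_central ideal_minus[OF I])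
      then show ?thesis
        using that s sc
        by (simp add: commutator3_mult_left_central_form s_central s_pol ideal_intros[OF I]
            J_mult[OF J_triple S_sub])
    qed
    then show "s \<in> ?V" using sc by simp
  qed
  moreover have "ideal ?V R"
  proof (rule idealI_closed)
    show "a \<oplus> b \<in> ?V" if "a \<in> ?V" "b \<in> ?V" for a b
      using that by (auto simp: r_distr commutator_add_left ideal_add[OF I])
    show "x \<otimes> a \<in> ?V" if "x \<in> carrier R" "a \<in> ?V" for x a
      using that by (auto simp flip: m_assoc)
    show "a \<otimes> x \<in> ?V" if x: "x \<in> carrier R" and a: "a \<in> ?V" for x a
    proof -
      have "\<lbrakk>d \<otimes> (a \<otimes> x), b, c\<rbrakk> \<in> I" if "d \<in> carrier R" "b \<in> carrier R" "c \<in> carrier R" for d b c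
      proof -
        have "d \<otimes> (a \<otimes> x) = \<lbrakk>d \<otimes> a, x\<rbrakk> \<oplus> x \<otimes> d \<otimes> a"
          using that x a unfolding commutator_def by simp algebra
        then have "\<lbrakk>d \<otimes> (a \<otimes> x), b, c\<rbrakk> = \<lbrakk>\<lbrakk>d \<otimes> a, x\<rbrakk>, b, c\<rbrakk> \<oplus> \<lbrakk>x \<otimes> d \<otimes> a, b, c\<rbrakk>"
          using that x a by (simp add: commutator_add_left)
        moreover have "\<lbrakk>d \<otimes> a, x, b\<rbrakk> \<in> I" "\<lbrakk>x \<otimes> d \<otimes> a, b, c\<rbrakk> \<in> I"
          using that x a by auto
        ultimately show ?thesis
          using that by (simp add: ideal_add[OF I] ideal_commutator_left[OF I])
      qed
      then show ?thesis using x a by simp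
    qed
  qed (auto simp: commutator_zero_left ideal_zero[OF I])
  ultimately have "Idl S \<subseteq> ?V"
    by (intro genideal_minimal)
  then have "\<lbrakk>\<one> \<otimes> u, b, c\<rbrakk> \<in> I" "u \<in> carrier R"
    using u b c one_closed by (blast, blast)
  then show ?thesis by simp
qed

end

end

section \<open>From algebras to rings\<close>

context assoc_algebra
begin

text \<open>
  Adjoining the scalars to \<open>X\<close> trades \<open>R\<close>-linearity for a larger generating set.
\<close>

lemma carrier_eq_generate_ring_scalars:
  assumes X: "X \<subseteq> carrier A" and gen: "generated_subalgebra R A X = carrier A"
  shows "generate_ring A (X \<union> {r \<odot>\<^bsub>A\<^esub> \<one>\<^bsub>A\<^esub> | r. r \<in> carrier R}) = carrier A"
    (is "generate_ring A ?Y = _")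
proof
  have Y: "?Y \<subseteq> carrier A" using X by auto
  show "generate_ring A ?Y \<subseteq> carrier A" by (rule A.generate_ring_incl[OF Y])
  have sub: "subring (generate_ring A ?Y) A"
    using A.generate_ring_is_subring[OF Y] .
  have "submodule (generate_ring A ?Y) R A"
  proof (rule submodule.intro)
    show "subgroup (generate_ring A ?Y) (add_monoid A)"
      using sub by (rule subring.axioms(1))
    show "submodule_axioms (generate_ring A ?Y) R A"
    proof
      fix r x assume r: "r \<in> carrier R" and x: "x \<in> generate_ring A ?Y"
      have xc: "x \<in> carrier A" using A.generate_ring_in_carrier[OF Y x] .
      have "r \<odot>\<^bsub>A\<^esub> x = (r \<odot>\<^bsub>A\<^esub> \<one>\<^bsub>A\<^esub>) \<otimes>\<^bsub>A\<^esub> x"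
        using r xc by (simp add: smult_mult_left)
      moreover have "r \<odot>\<^bsub>A\<^esub> \<one>\<^bsub>A\<^esub> \<in> generate_ring A ?Y"
        using r by (auto intro!: generate_ring.incl)
      ultimately show "r \<odot>\<^bsub>A\<^esub> x \<in> generate_ring A ?Y"
        using x by (simp add: generate_ring.eng_mult)
    qed
  qed
  moreover have "X \<subseteq> generate_ring A ?Y"
    by (auto intro: generate_ring.incl)
  ultimately have "generated_subalgebra R A X \<subseteq> generate_ring A ?Y"
    unfolding generated_subalgebra_def using sub by blast
  then show "carrier A \<subseteq> generate_ring A ?Y"
    by (simp only: gen)
qed

lemma commutator_scalar:
  assumes "r \<in> carrier R" "a \<in> carrier A"
  shows "\<lbrakk>r \<odot>\<^bsub>A\<^esub> \<one>\<^bsub>A\<^esub>, a\<rbrakk>\<^bsub>A\<^esub> = \<zero>\<^bsub>A\<^esub>" and "\<lbrakk>a, r \<odot>\<^bsub>A\<^esub> \<one>\<^bsub>A\<^esub>\<rbrakk>\<^bsub>A\<^esub> = \<zero>\<^bsub>A\<^esub>"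
proof -
  have "(r \<odot>\<^bsub>A\<^esub> \<one>\<^bsub>A\<^esub>) \<otimes>\<^bsub>A\<^esub> a = r \<odot>\<^bsub>A\<^esub> a" "a \<otimes>\<^bsub>A\<^esub> (r \<odot>\<^bsub>A\<^esub> \<one>\<^bsub>A\<^esub>) = r \<odot>\<^bsub>A\<^esub> a"
    using assms by (simp_all add: smult_mult_left smult_mult_right)
  moreover have "r \<odot>\<^bsub>A\<^esub> a \<ominus>\<^bsub>A\<^esub> r \<odot>\<^bsub>A\<^esub> a = \<zero>\<^bsub>A\<^esub>"
    using assms by (simp only: a_minus_def M.r_neg smult_closed)
  ultimately show "\<lbrakk>r \<odot>\<^bsub>A\<^esub> \<one>\<^bsub>A\<^esub>, a\<rbrakk>\<^bsub>A\<^esub> = \<zero>\<^bsub>A\<^esub>" "\<lbrakk>a, r \<odot>\<^bsub>A\<^esub> \<one>\<^bsub>A\<^esub>\<rbrakk>\<^bsub>A\<^esub> = \<zero>\<^bsub>A\<^esub>"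
    by (simp_all only: commutator_def)
qed

lemma mem_ideal_if_triple_mem:
  assumes three: "\<one> \<oplus> \<one> \<oplus> \<one> \<in> Units R" and I: "ideal I A"
    and a: "a \<in> carrier A" and mem: "a \<oplus>\<^bsub>A\<^esub> a \<oplus>\<^bsub>A\<^esub> a \<in> I"
  shows "a \<in> I"
proof -
  let ?t = "inv (\<one> \<oplus> \<one> \<oplus> \<one>)"
  have t: "?t \<in> carrier R" using three by simp
  have "a = (?t \<otimes> (\<one> \<oplus> \<one> \<oplus> \<one>)) \<odot>\<^bsub>A\<^esub> a"
    using three a by simp
  also have "\<dots> = ?t \<odot>\<^bsub>A\<^esub> (\<one>\<^bsub>A\<^esub> \<otimes>\<^bsub>A\<^esub> (a \<oplus>\<^bsub>A\<^esub> a \<oplus>\<^bsub>A\<^esub> a))"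
    using t a by (simp add: smult_assoc1 smult_l_distr)
  also have "\<dots> = (?t \<odot>\<^bsub>A\<^esub> \<one>\<^bsub>A\<^esub>) \<otimes>\<^bsub>A\<^esub> (a \<oplus>\<^bsub>A\<^esub> a \<oplus>\<^bsub>A\<^esub> a)"
    using t a by (simp only: smult_mult_left A.one_closed M.a_closed)
  also have "\<dots> \<in> I"
    using mem t by (intro A.ideal_mult_left[OF I]) auto
  finally show ?thesis .
qed

text \<open>
  A scalar is central, and each of the four families vanishes as soon as one of its arguments
  from the generating set is central. So the families over \<open>X\<close> control those over \<open>X\<close>
  together with the scalars, and the theorem for rings applies.
\<close>

lemma commutator3_mem_if_families_subalgebra:
  assumes three: "\<one> \<oplus> \<one> \<oplus> \<one> \<in> Units R"
    and X: "X \<subseteq> carrier A" and gen: "generated_subalgebra R A X = carrier A"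
    and S: "S \<subseteq> carrier A" and I: "ideal I A"
    and f1: "\<And>s x y. \<lbrakk>s \<in> S; x \<in> X; y \<in> X\<rbrakk> \<Longrightarrow> \<lbrakk>s, x, y\<rbrakk>\<^bsub>A\<^esub> \<in> I"
    and f2: "\<And>s x y z. \<lbrakk>s \<in> S; x \<in> X; y \<in> X; z \<in> X\<rbrakk> \<Longrightarrow> s \<otimes>\<^bsub>A\<^esub> \<lbrakk>x, y, z\<rbrakk>\<^bsub>A\<^esub> \<in> I"
    and f3: "\<And>s x y z. \<lbrakk>s \<in> S; x \<in> X; y \<in> X; z \<in> X\<rbrakk> \<Longrightarrow> A.polarized s x y z \<in> I"
    and f4: "\<And>s w x y z. \<lbrakk>s \<in> S; w \<in> X; x \<in> X; y \<in> X; z \<in> X\<rbrakk>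
      \<Longrightarrow> s \<otimes>\<^bsub>A\<^esub> A.polarized w x y z \<in> I"
    and u: "u \<in> Idl\<^bsub>A\<^esub> S" and bc: "b \<in> carrier A" "c \<in> carrier A"
  shows "\<lbrakk>u, b, c\<rbrakk>\<^bsub>A\<^esub> \<in> I"
proof (rule A.commutator3_mem_if_families[OF I S _ carrier_eq_generate_ring_scalars[OF X gen] _ _ _ _ _ u bc])
  let ?Y = "X \<union> {r \<odot>\<^bsub>A\<^esub> \<one>\<^bsub>A\<^esub> | r. r \<in> carrier R}"
  show Y: "?Y \<subseteq> carrier A" using X by auto
  have scalar: "\<lbrakk>x, a\<rbrakk>\<^bsub>A\<^esub> = \<zero>\<^bsub>A\<^esub>" "\<lbrakk>a, x\<rbrakk>\<^bsub>A\<^esub> = \<zero>\<^bsub>A\<^esub>"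
    if "x \<in> ?Y" "x \<notin> X" "a \<in> carrier A" for x a
    using that by (auto simp: commutator_scalar)
  have zero: "\<zero>\<^bsub>A\<^esub> \<in> I"
    by (rule A.ideal_zero[OF I])
  have Sc: "s \<in> carrier A" if "s \<in> S" for s
    using that S by blast
  show "\<lbrakk>s, x, y\<rbrakk>\<^bsub>A\<^esub> \<in> I" if s: "s \<in> S" and xy: "x \<in> ?Y" "y \<in> ?Y" for s x y
  proof (cases "x \<in> X \<and> y \<in> X")
    case False
    note facts = Sc[OF s] xy[THEN subsetD[OF Y]] xy[THEN scalar(1)] xy[THEN scalar(2)]
    have "\<lbrakk>s, x, y\<rbrakk>\<^bsub>A\<^esub> = \<zero>\<^bsub>A\<^esub>"
      using False facts by (cases "x \<in> X") (simp_all add: A.commutator_zero_left)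
    then show ?thesis using zero by simp
  qed (use s f1 in blast)
  show "s \<otimes>\<^bsub>A\<^esub> \<lbrakk>x, y, z\<rbrakk>\<^bsub>A\<^esub> \<in> I"
    if s: "s \<in> S" and xyz: "x \<in> ?Y" "y \<in> ?Y" "z \<in> ?Y" for s x y z
  proof (cases "x \<in> X \<and> y \<in> X \<and> z \<in> X")
    case False
    note facts = Sc[OF s] xyz[THEN subsetD[OF Y]] xyz[THEN scalar(1)] xyz[THEN scalar(2)]
    have "\<lbrakk>x, y, z\<rbrakk>\<^bsub>A\<^esub> = \<zero>\<^bsub>A\<^esub>"
      using False facts
      by (cases "x \<in> X"; cases "y \<in> X") (simp_all add: A.commutator_zero_left)
    then show ?thesis using zero facts(1) by simp
  qed (use s f2 in blast)
  show "A.polarized s x y z \<in> I"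
    if s: "s \<in> S" and xyz: "x \<in> ?Y" "y \<in> ?Y" "z \<in> ?Y" for s x y z
  proof (cases "x \<in> X \<and> y \<in> X \<and> z \<in> X")
    case False
    note facts = Sc[OF s] xyz[THEN subsetD[OF Y]] xyz[THEN scalar(1)] xyz[THEN scalar(2)]
    have "A.polarized s x y z = \<zero>\<^bsub>A\<^esub>"
      using False facts by (cases "x \<in> X"; cases "y \<in> X") simp_all
    then show ?thesis using zero by simp
  qed (use s f3 in blast)
  show "s \<otimes>\<^bsub>A\<^esub> A.polarized w x y z \<in> I"
    if s: "s \<in> S" and wxyz: "w \<in> ?Y" "x \<in> ?Y" "y \<in> ?Y" "z \<in> ?Y" for s w x y z
  proof (cases "w \<in> X \<and> x \<in> X \<and> y \<in> X \<and> z \<in> X")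
    case False
    note facts = Sc[OF s] wxyz[THEN subsetD[OF Y]] wxyz[THEN scalar(1)] wxyz[THEN scalar(2)]
    have "A.polarized w x y z = \<zero>\<^bsub>A\<^esub>"
      using False facts by (cases "w \<in> X"; cases "x \<in> X"; cases "y \<in> X") simp_all
    then show ?thesis using zero facts(1) by simp
  qed (use s f4 in blast)
  show "a \<in> I" if "a \<in> carrier A" "a \<oplus>\<^bsub>A\<^esub> a \<oplus>\<^bsub>A\<^esub> a \<in> I" for a
    using that by (rule mem_ideal_if_triple_mem[OF three I])
qed

end

theorem corollary1p6:
  fixes R :: "('r, 'm) ring_scheme"
    and A :: "('r, 'a, 'n) module_scheme"
    and X S U W :: "'a set"
  assumes "assoc_algebra R A"
    and "\<one>\<^bsub>R\<^esub> \<oplus>\<^bsub>R\<^esub> \<one>\<^bsub>R\<^esub> \<oplus>\<^bsub>R\<^esub> \<one>\<^bsub>R\<^esub> \<in> Units R"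
    and "X \<subseteq> carrier A"
    and "generated_subalgebra R A X = carrier A"
    and "S \<subseteq> carrier A"
    and "U = Idl\<^bsub>A\<^esub> S"
    and "W = Idl\<^bsub>A\<^esub> {\<lbrakk>u, a1, a2\<rbrakk>\<^bsub>A\<^esub> | u a1 a2. u \<in> U \<and> a1 \<in> carrier A \<and> a2 \<in> carrier A}"
  shows "W = Idl\<^bsub>A\<^esub>
    ({\<lbrakk>s, x1, x2\<rbrakk>\<^bsub>A\<^esub> | s x1 x2. s \<in> S \<and> x1 \<in> X \<and> x2 \<in> X}
   \<union> {s \<otimes>\<^bsub>A\<^esub> \<lbrakk>x1, x2, x3\<rbrakk>\<^bsub>A\<^esub> | s x1 x2 x3. s \<in> S \<and> x1 \<in> X \<and> x2 \<in> X \<and> x3 \<in> X}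
   \<union> {\<lbrakk>s, x1\<rbrakk>\<^bsub>A\<^esub> \<otimes>\<^bsub>A\<^esub> \<lbrakk>x2, x3\<rbrakk>\<^bsub>A\<^esub> \<oplus>\<^bsub>A\<^esub> \<lbrakk>s, x2\<rbrakk>\<^bsub>A\<^esub> \<otimes>\<^bsub>A\<^esub> \<lbrakk>x1, x3\<rbrakk>\<^bsub>A\<^esub>
        | s x1 x2 x3. s \<in> S \<and> x1 \<in> X \<and> x2 \<in> X \<and> x3 \<in> X}
   \<union> {s \<otimes>\<^bsub>A\<^esub> (\<lbrakk>x1, x2\<rbrakk>\<^bsub>A\<^esub> \<otimes>\<^bsub>A\<^esub> \<lbrakk>x3, x4\<rbrakk>\<^bsub>A\<^esub> \<oplus>\<^bsub>A\<^esub> \<lbrakk>x1, x3\<rbrakk>\<^bsub>A\<^esub> \<otimes>\<^bsub>A\<^esub> \<lbrakk>x2, x4\<rbrakk>\<^bsub>A\<^esub>)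
        | s x1 x2 x3 x4. s \<in> S \<and> x1 \<in> X \<and> x2 \<in> X \<and> x3 \<in> X \<and> x4 \<in> X})"
proof -
  interpret assoc_algebra R A by fact
  note X = assms(3) and S = assms(5)
  let ?C = "{\<lbrakk>u, a1, a2\<rbrakk>\<^bsub>A\<^esub> | u a1 a2. u \<in> U \<and> a1 \<in> carrier A \<and> a2 \<in> carrier A}"
  let ?F1 = "{\<lbrakk>s, x1, x2\<rbrakk>\<^bsub>A\<^esub> | s x1 x2. s \<in> S \<and> x1 \<in> X \<and> x2 \<in> X}"
  let ?F2 = "{s \<otimes>\<^bsub>A\<^esub> \<lbrakk>x1, x2, x3\<rbrakk>\<^bsub>A\<^esub> | s x1 x2 x3. s \<in> S \<and> x1 \<in> X \<and> x2 \<in> X \<and> x3 \<in> X}"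
  let ?F3 = "{A.polarized s x1 x2 x3 | s x1 x2 x3. s \<in> S \<and> x1 \<in> X \<and> x2 \<in> X \<and> x3 \<in> X}"
  let ?F4 = "{s \<otimes>\<^bsub>A\<^esub> A.polarized x1 x2 x3 x4
    | s x1 x2 x3 x4. s \<in> S \<and> x1 \<in> X \<and> x2 \<in> X \<and> x3 \<in> X \<and> x4 \<in> X}"
  define F where "F = ?F1 \<union> ?F2 \<union> ?F3 \<union> ?F4"
  have carr: "s \<in> S \<Longrightarrow> s \<in> carrier A" "x \<in> X \<Longrightarrow> x \<in> carrier A" for s x
    using X S by auto
  have U: "ideal U A"
    unfolding assms(6) by (rule A.genideal_ideal[OF S])
  have U_carr: "u \<in> carrier A" if "u \<in> U" for u
    using ideal.Icarr[OF U that] .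
  have SU: "s \<in> U" if "s \<in> S" for s
    unfolding assms(6) using that A.genideal_self[OF S] by blast
  have C: "?C \<subseteq> carrier A"
    using U_carr by auto
  have W: "ideal W A"
    unfolding assms(7) by (rule A.genideal_ideal[OF C])
  have UW: "\<lbrakk>u, a, b\<rbrakk>\<^bsub>A\<^esub> \<in> W" if "u \<in> U" "a \<in> carrier A" "b \<in> carrier A" for u a b
    unfolding assms(7) by (rule subsetD[OF A.genideal_self[OF C]]) (use that in blast)
  have F: "F \<subseteq> carrier A"
    unfolding F_def using carr by auto
  have I: "ideal (Idl\<^bsub>A\<^esub> F) A"
    by (rule A.genideal_ideal[OF F])
  have "F \<subseteq> Idl\<^bsub>A\<^esub> F"
    by (rule A.genideal_self[OF F])
  then have F1: "?F1 \<subseteq> Idl\<^bsub>A\<^esub> F" and F2: "?F2 \<subseteq> Idl\<^bsub>A\<^esub> F"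
    and F3: "?F3 \<subseteq> Idl\<^bsub>A\<^esub> F" and F4: "?F4 \<subseteq> Idl\<^bsub>A\<^esub> F"
    unfolding F_def by (simp_all only: Un_subset_iff)
  have "\<lbrakk>u, b, c\<rbrakk>\<^bsub>A\<^esub> \<in> Idl\<^bsub>A\<^esub> F" if "u \<in> U" "b \<in> carrier A" "c \<in> carrier A" for u b c
  proof (rule commutator3_mem_if_families_subalgebra[OF assms(2) X assms(4) S I])
    show "u \<in> Idl\<^bsub>A\<^esub> S" "b \<in> carrier A" "c \<in> carrier A"
      using that assms(6) by simp_all
    show "\<lbrakk>s, x, y\<rbrakk>\<^bsub>A\<^esub> \<in> Idl\<^bsub>A\<^esub> F" if "s \<in> S" "x \<in> X" "y \<in> X" for s x y
      by (rule subsetD[OF F1]) (use that in blast)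
    show "s \<otimes>\<^bsub>A\<^esub> \<lbrakk>x, y, z\<rbrakk>\<^bsub>A\<^esub> \<in> Idl\<^bsub>A\<^esub> F"
      if "s \<in> S" "x \<in> X" "y \<in> X" "z \<in> X" for s x y z
      by (rule subsetD[OF F2]) (use that in blast)
    show "A.polarized s x y z \<in> Idl\<^bsub>A\<^esub> F" if "s \<in> S" "x \<in> X" "y \<in> X" "z \<in> X" for s x y z
      by (rule subsetD[OF F3]) (use that in blast)
    show "s \<otimes>\<^bsub>A\<^esub> A.polarized w x y z \<in> Idl\<^bsub>A\<^esub> F"
      if "s \<in> S" "w \<in> X" "x \<in> X" "y \<in> X" "z \<in> X" for s w x y z
      by (rule subsetD[OF F4]) (use that in blast)
  qed
  then have "W \<subseteq> Idl\<^bsub>A\<^esub> F"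
    unfolding assms(7) by (intro A.genideal_minimal[OF I]) blast
  moreover have "F \<subseteq> W"
    unfolding F_def
  proof (intro Un_least)
    show "?F1 \<subseteq> W"
      by clarify (rule UW; simp add: SU carr)
    show "?F2 \<subseteq> W"
      by clarify (rule A.mult_commutator3_mem[OF U W UW]; simp add: SU carr)
    show "?F3 \<subseteq> W"
      by clarify (rule A.polarized_mem[OF U W UW]; simp add: SU carr)
    show "?F4 \<subseteq> W"
      by clarify (rule A.mult_polarized_mem[OF U W UW]; simp add: SU carr)
  qed
  then have "Idl\<^bsub>A\<^esub> F \<subseteq> W"
    by (rule A.genideal_minimal[OF W])
  ultimately show ?thesis
    unfolding F_def by blast
qed

end
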